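(* For integers $s\ge1$ and $N\ge1$ let $J_s(N)$ denote the number of integer solutions $(x_i,y_i,z_i)_{1\le i\le 2s}$, with all $x_i,y_i,z_i\in\{0,1,\dots,N\}$, of the system $$\sum_{i=1}^s x_i=\sum_{i=s+1}^{2s}x_i,\quad \sum_{i=1}^s y_i=\sum_{i=s+1}^{2s}y_i,\quad \sum_{i=1}^s z_i=\sum_{i=s+1}^{2s}z_i,$$ $$\sum_{i=1}^s x_i^2=\sum_{i=s+1}^{2s}x_i^2,\quad \sum_{i=1}^s (y_i^2+x_iz_i)=\sum_{i=s+1}^{2s}(y_i^2+x_iz_i).$$ Then for every $s\ge1$ and every $\epsilon>0$ there is a constant $C_{s,\epsilon}$ such that for all $N\ge 1$ $$J_s(N)\le C_{s,\epsilon}\left(N^{3s+\epsilon}+N^{5s-4+\epsilon}+N^{6s-7+\epsilon}\right).$$ In particular, $J_2(N)\lesssim_\epsilon N^{6+\epsilon}$ for every $\epsilon>0$.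
   Context: The notation $A\lesssim_\epsilon B$ means $A\le C_\epsilon B$ with a constant $C_\epsilon$ depending only on $\epsilon$ (in particular not on $N$). *)

theory Defs
  imports "HOL-Analysis.Analysis"
begin

text \<open>
  A solution is a triple of coordinate families indexed by \<open>{1..2 * s}\<close>. The families are taken
  extensional (fixed outside the index set), so that each solution is counted exactly once.
\<close>

definition solutions :: "nat \<Rightarrow> nat \<Rightarrow> ((nat \<Rightarrow> nat) \<times> (nat \<Rightarrow> nat) \<times> (nat \<Rightarrow> nat)) set" where
  "solutions s N = {(x, y, z).
     x \<in> {1..2 * s} \<rightarrow>\<^sub>E {0..N} \<and>
     y \<in> {1..2 * s} \<rightarrow>\<^sub>E {0..N} \<and>
     z \<in> {1..2 * s} \<rightarrow>\<^sub>E {0..N} \<and>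
     (\<Sum>i = 1..s. x i) = (\<Sum>i = s + 1..2 * s. x i) \<and>
     (\<Sum>i = 1..s. y i) = (\<Sum>i = s + 1..2 * s. y i) \<and>
     (\<Sum>i = 1..s. z i) = (\<Sum>i = s + 1..2 * s. z i) \<and>
     (\<Sum>i = 1..s. (x i)\<^sup>2) = (\<Sum>i = s + 1..2 * s. (x i)\<^sup>2) \<and>
     (\<Sum>i = 1..s. (y i)\<^sup>2 + x i * z i) = (\<Sum>i = s + 1..2 * s. (y i)\<^sup>2 + x i * z i)}"

lemma finite_solutions: "finite (solutions s N)"
proof (rule finite_subset)
  let ?F = "{1..2 * s} \<rightarrow>\<^sub>E {0..N}"
  show "solutions s N \<subseteq> ?F \<times> ?F \<times> ?F"
    unfolding solutions_def by blast
  show "finite (?F \<times> ?F \<times> ?F)"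
    by (intro finite_cartesian_product finite_PiE) auto
qed

definition J :: "nat \<Rightarrow> nat \<Rightarrow> nat" where
  "J s N = card (solutions s N)"

end

theory Submission
  imports Defs "HOL-Computational_Algebra.Primes"
begin

text \<open>
  Everything is elementary: apart from linear algebra, the only arithmetic input is the divisor
  bound \<open>\<tau>(n) \<le> C\<^sub>\<epsilon> n\<^sup>\<epsilon>\<close>. Write \<open>E\<^sub>s\<close> for the number of pairs of \<open>s\<close>-tuples of points of
  \<open>{0..N}\<^sup>3\<close> with equal sums of \<open>(x, y, z, x\<^sup>2, y\<^sup>2 + x z)\<close>, so that \<open>J s N\<close> is \<open>E\<^sub>s\<close>. The three powers
  in the bound meet at \<open>s = 2\<close> (first and second) and at \<open>s = 3\<close> (second and third), so it
  suffices to treat \<open>s = 1\<close> (trivial), \<open>s = 2\<close> (\<open>N\<close> to the power 6), \<open>s = 3\<close> (\<open>N\<close> to the power 11), and to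
  lose no more than the trivial factor \<open>O(N\<^sup>6)\<close> in each further step. The last point is
  \<open>energy_Suc\<close>: fixing one point on either side shifts the system by a constant vector, and by
  Cauchy--Schwarz (\<open>energy_shift\<close>) a shifted system has at most as many solutions as the
  homogeneous one.

  The basic estimate is \<open>card_bilinear_solutions\<close>: for every \<open>m\<close>, the equation \<open>p u + q v = m\<close> has
  \<open>O(N\<^sup>2\<^sup>+\<^sup>\<epsilon>)\<close> solutions in a box of side \<open>O(N)\<close>, since \<open>q\<close> and \<open>v\<close> leave for \<open>p\<close> and \<open>u\<close>
  only factorisations of a given number.

  For \<open>s = 2\<close> the equations for \<open>x\<close> force \<open>{x\<^sub>1, x\<^sub>2} = {x\<^sub>3, x\<^sub>4}\<close>. If \<open>x\<^sub>1 = x\<^sub>3\<close>, the remaining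
  quadratic equation becomes
  \<open>(x\<^sub>1 - x\<^sub>2) (z\<^sub>1 - z\<^sub>3) + 2 (y\<^sub>1 - y\<^sub>3) (y\<^sub>3 - y\<^sub>2) = 0\<close>,
  of the above type, and four further coordinates are free.

  For \<open>s = 3\<close>, fix \<open>y\<^sub>1, \<dots>, y\<^sub>5\<close>; this leaves \<open>energy_3\<close> with the task of counting \<open>(x, z)\<close> with
  \<open>x\<^sub>1 z\<^sub>1 + x\<^sub>2 z\<^sub>2 + x\<^sub>3 z\<^sub>3 - x\<^sub>4 z\<^sub>4 - x\<^sub>5 z\<^sub>5 - x\<^sub>6 z\<^sub>6 = m\<close>, uniformly in \<open>m\<close>, and the target is
  \<open>O(N\<^sup>6\<^sup>+\<^sup>\<epsilon>)\<close>. If \<open>x\<^sub>6\<close> is one of \<open>x\<^sub>1, x\<^sub>2, x\<^sub>3\<close>, then \<open>(x\<^sub>4, x\<^sub>5, x\<^sub>6)\<close> is a permutation of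
  \<open>(x\<^sub>1, x\<^sub>2, x\<^sub>3)\<close> and the equation is again bilinear with four free coordinates
  (\<open>card_twisted_solutions_diagonal\<close>). Otherwise put \<open>a = x\<^sub>1 - x\<^sub>6\<close> and \<open>b = x\<^sub>2 - x\<^sub>6\<close>; the equations
  for \<open>x\<close> amount to \<open>(x\<^sub>4 - x\<^sub>6 - a - b) (x\<^sub>5 - x\<^sub>6 - a - b) = a b \<noteq> 0\<close>, so \<open>a\<close>, \<open>b\<close>, \<open>x\<^sub>6\<close> determine
  \<open>x\<close> up to a divisor of \<open>a b\<close>, and once \<open>x, z\<^sub>3, z\<^sub>4, z\<^sub>5\<close> are known, any two choices of
  \<open>(z\<^sub>1, z\<^sub>2)\<close> differ by some \<open>(u, v)\<close> with \<open>a u + b v = 0\<close>, to which the basic estimate applies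
  with \<open>a\<close> and \<open>b\<close> as variables too (\<open>card_twisted_solutions_off_diagonal\<close>).
\<close>

section \<open>The divisor bound\<close>

lemma card_divisors_mult_le:
  fixes a b :: nat
  assumes "a > 0" "b > 0"
  shows "card {d. d dvd a * b} \<le> card {d. d dvd a} * card {d. d dvd b}"
proof -
  have "{d. d dvd a * b} \<subseteq> (\<lambda>(u, v). u * v) ` ({d. d dvd a} \<times> {d. d dvd b})"
    by (auto dest!: division_decomp)
  moreover have fin: "finite ({d. d dvd a} \<times> {d. d dvd b})"
    using assms by simp
  ultimately have "card {d. d dvd a * b} \<le> card ({d. d dvd a} \<times> {d. d dvd b})"
    by (metis card_image_le card_mono finite_imageI le_trans)
  then show ?thesis by (simp add: card_cartesian_product)
qed

lemma card_divisors_prime_power: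
  fixes p :: nat
  assumes "prime p"
  shows "card {d. d dvd p ^ a} = a + 1"
proof -
  have "{d. d dvd p ^ a} = (\<lambda>i. p ^ i) ` {..a}"
    using divides_primepow_nat[OF assms] by auto
  moreover have "inj_on (\<lambda>i. p ^ i) {..a}"
    using prime_gt_1_nat[OF assms] by (auto simp: inj_on_def)
  ultimately show ?thesis by (simp add: card_image)
qed

text \<open>
  Primes \<open>p\<close> with \<open>p\<^sup>\<epsilon> \<ge> 2\<close> cost nothing: splitting off one of them at most doubles the number of
  divisors, and multiplies \<open>n\<^sup>\<epsilon>\<close> by at least 2.
\<close>

lemma divisor_bound_rough:
  fixes \<epsilon> :: real and j :: nat
  assumes \<epsilon>: "\<epsilon> > 0" and j: "real j \<ge> 2 powr (1 / \<epsilon>)"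
  shows "n > 0 \<Longrightarrow> (\<And>p. prime p \<Longrightarrow> p dvd n \<Longrightarrow> j \<le> p) \<Longrightarrow>
    real (card {d. d dvd n}) \<le> real n powr \<epsilon>"
proof (induction n rule: less_induct)
  case (less n)
  show ?case
  proof (cases "n = 1")
    case True
    then show ?thesis by simp
  next
    case False
    then obtain p where p: "prime p" "p dvd n"
      using prime_factor_nat by blast
    then obtain m where m: "n = p * m" by blast
    have "m > 0" "m < n"
      using m p less.prems prime_gt_1_nat[of p] by auto
    then have IH: "real (card {d. d dvd m}) \<le> real m powr \<epsilon>"
      using less m by auto
    have "2 = (2 powr (1 / \<epsilon>)) powr \<epsilon>"
      using \<epsilon> by (simp add: powr_powr)
    also have "\<dots> \<le> real p powr \<epsilon>"
      using j \<epsilon> less.prems(2)[OF p] by (intro powr_mono2) auto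
    finally have two: "2 \<le> real p powr \<epsilon>" .
    have "card {d. d dvd n} \<le> 2 * card {d. d dvd m}"
      using card_divisors_mult_le[of p m] card_divisors_prime_power[OF p(1), of 1] m less.prems
      by simp
    then have "real (card {d. d dvd n}) \<le> 2 * real (card {d. d dvd m})" by linarith
    also have "\<dots> \<le> real p powr \<epsilon> * real m powr \<epsilon>"
      using two IH by (intro mult_mono) auto
    also have "\<dots> = real n powr \<epsilon>"
      by (simp add: m powr_mult)
    finally show ?thesis .
  qed
qed

text \<open>
  The constant does not depend on \<open>p\<close> because \<open>p \<ge> 2\<close>, and \<open>2\<^sup>a\<^sup>\<epsilon> \<ge> 1 + a \<epsilon> ln 2\<close>.
\<close>

lemma card_divisors_prime_power_le:
  fixes \<epsilon> :: real and p :: nat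
  assumes \<epsilon>: "\<epsilon> > 0" and p: "prime p"
  shows "real (a + 1) \<le> (1 + 1 / (\<epsilon> * ln 2)) * real (p ^ a) powr \<epsilon>"
proof -
  define c where "c = \<epsilon> * ln (2::real)"
  have c: "c > 0" using \<epsilon> by (simp add: c_def)
  have "real (a + 1) \<le> (1 + 1 / c) * (1 + real a * c)"
    using c by (simp add: field_simps)
  also have "\<dots> \<le> (1 + 1 / c) * real (p ^ a) powr \<epsilon>"
  proof (rule mult_left_mono)
    have "1 + real a * c \<le> exp (real a * c)"
      by (rule exp_ge_add_one_self)
    also have "\<dots> = (2 ^ a) powr \<epsilon>"
      by (simp add: c_def powr_def ln_realpow)
    also have "\<dots> \<le> real (p ^ a) powr \<epsilon>"
      using \<epsilon> prime_ge_2_nat[OF p] by (intro powr_mono2) (auto simp: power_mono)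
    finally show "1 + real a * c \<le> real (p ^ a) powr \<epsilon>" .
  qed (use c in simp)
  finally show ?thesis by (simp add: c_def)
qed

text \<open>
  The finitely many primes below \<open>2\<^sup>1\<^sup>/\<^sup>\<epsilon>\<close> are removed one at a time: \<open>P j\<close> below is the bound for
  numbers without prime factors smaller than \<open>j\<close>, and passing from \<open>P (Suc j)\<close> to \<open>P j\<close> multiplies
  the constant by at most the factor of \<open>card_divisors_prime_power_le\<close>.
\<close>

proposition divisor_bound:
  fixes \<epsilon> :: real
  assumes \<epsilon>: "\<epsilon> > 0"
  shows "\<exists>C. \<forall>n::nat. n > 0 \<longrightarrow> real (card {d. d dvd n}) \<le> C * real n powr \<epsilon>"
proof -
  define B where "B = 1 + 1 / (\<epsilon> * ln (2::real))"
  have B: "B \<ge> 1" using \<epsilon> by (simp add: B_def)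
  define P where "P = (\<lambda>j::nat. \<exists>C\<ge>0. \<forall>n::nat. n > 0 \<longrightarrow> (\<forall>p. prime p \<longrightarrow> p dvd n \<longrightarrow> j \<le> p)
    \<longrightarrow> real (card {d. d dvd n}) \<le> C * real n powr \<epsilon>)"
  define j0 where "j0 = nat \<lceil>2 powr (1 / \<epsilon>)\<rceil>"
  have "P j0"
    unfolding P_def
    using divisor_bound_rough[OF \<epsilon>, of j0] real_nat_ceiling_ge[of "2 powr (1 / \<epsilon>)"]
    by (intro exI[of _ 1]) (auto simp: j0_def)
  moreover have "P j" if "P (Suc j)" for j
  proof -
    from that obtain C where C: "C \<ge> 0" and bound: "\<And>n. n > 0 \<Longrightarrow>
      (\<And>p. prime p \<Longrightarrow> p dvd n \<Longrightarrow> Suc j \<le> p) \<Longrightarrow> real (card {d. d dvd n}) \<le> C * real n powr \<epsilon>"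
      unfolding P_def by blast
    have "real (card {d. d dvd n}) \<le> B * C * real n powr \<epsilon>"
      if n: "n > 0" and rough: "\<And>p. prime p \<Longrightarrow> p dvd n \<Longrightarrow> j \<le> p" for n
    proof (cases "prime j")
      case False
      then have "real (card {d. d dvd n}) \<le> C * real n powr \<epsilon>"
      proof (intro bound[OF n])
        show "Suc j \<le> p" if "prime p" "p dvd n" for p
          using rough[OF that] that False by (cases "p = j") auto
      qed
      also have "\<dots> \<le> B * C * real n powr \<epsilon>"
        using B C mult_right_mono[of 1 B "C * real n powr \<epsilon>"] by simp
      finally show ?thesis .
    next
      case True
      obtain m where m: "n = j ^ multiplicity j n * m" "\<not> j dvd m"
        using n True not_prime_unit[of j] by (auto intro: multiplicity_decompose'[of n j])
      define a where "a = multiplicity j n"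
      have m': "n = j ^ a * m" using m a_def by simp
      have pos: "j ^ a > 0" "m > 0" using m' n by auto
      have M: "real (card {d. d dvd m}) \<le> C * real m powr \<epsilon>"
      proof (rule bound)
        show "Suc j \<le> p" if "prime p" "p dvd m" for p
          using rough[of p] that m(2) m' by (cases "p = j") auto
      qed (use pos in auto)
      have "real (card {d. d dvd n}) \<le> real (a + 1) * real (card {d. d dvd m})"
        using card_divisors_mult_le[OF pos] card_divisors_prime_power[OF True, of a] m'
        by (metis of_nat_le_iff of_nat_mult)
      also have "\<dots> \<le> (B * real (j ^ a) powr \<epsilon>) * (C * real m powr \<epsilon>)"
        using card_divisors_prime_power_le[OF \<epsilon> True, of a] M B by (intro mult_mono) (auto simp: B_def)
      also have "\<dots> = B * C * real n powr \<epsilon>"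
        by (simp add: m' powr_mult)
      finally show ?thesis .
    qed
    then show ?thesis
      unfolding P_def using B C by (intro exI[of _ "B * C"]) auto
  qed
  ultimately have "P 0"
    using inc_induct[of 0 j0 P] by simp
  then show ?thesis unfolding P_def by auto
qed

text \<open>
  The counting arguments use a single bound \<open>D\<close> for all numbers in sight, and stay within exact
  inequalities between natural numbers; \<open>D\<close> is replaced by \<open>C N\<^sup>\<epsilon>\<close> only at the very end.
\<close>

definition divisors_at_most :: "nat \<Rightarrow> int \<Rightarrow> bool" where
  "divisors_at_most D X \<longleftrightarrow> (\<forall>n::int. n \<noteq> 0 \<longrightarrow> \<bar>n\<bar> \<le> X \<longrightarrow> card {d. d dvd n} \<le> D)"

text \<open>
  Guarding the set of divisors by the conditions on \<open>n\<close> makes the bound unconditional, so that it can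
  be applied to all members of a family in \<open>card_cover\<close>.
\<close>

lemma divisors_at_mostD:
  assumes "divisors_at_most D X"
  shows "finite {d. d dvd n \<and> n \<noteq> 0 \<and> \<bar>n\<bar> \<le> X}" "card {d. d dvd n \<and> n \<noteq> 0 \<and> \<bar>n\<bar> \<le> X} \<le> D"
proof -
  have "{d. d dvd n \<and> n \<noteq> 0 \<and> \<bar>n\<bar> \<le> X} = (if n \<noteq> 0 \<and> \<bar>n\<bar> \<le> X then {d. d dvd n} else {})"
    by auto
  then show "finite {d. d dvd n \<and> n \<noteq> 0 \<and> \<bar>n\<bar> \<le> X}"
    "card {d. d dvd n \<and> n \<noteq> 0 \<and> \<bar>n\<bar> \<le> X} \<le> D"
    using assms by (simp_all add: divisors_at_most_def)
qed

lemma divisors_at_most_mono: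
  "divisors_at_most D X \<Longrightarrow> Y \<le> X \<Longrightarrow> divisors_at_most D Y"
  by (auto simp: divisors_at_most_def)

lemma card_int_divisors_le:
  fixes n :: int
  assumes "n \<noteq> 0"
  shows "card {d. d dvd n} \<le> 2 * card {d. d dvd nat \<bar>n\<bar>}"
proof -
  define T where "T = {d. d dvd nat \<bar>n\<bar>}"
  have fin: "finite T" using assms unfolding T_def by (intro finite_divisors_nat) simp
  have "{d. d dvd n} \<subseteq> int ` T \<union> (\<lambda>d. - int d) ` T"
  proof
    fix d assume "d \<in> {d. d dvd n}"
    then have "nat \<bar>d\<bar> \<in> T" by (simp add: T_def nat_dvd_iff)
    moreover have "d = int (nat \<bar>d\<bar>) \<or> d = - int (nat \<bar>d\<bar>)" by linarith
    ultimately show "d \<in> int ` T \<union> (\<lambda>d. - int d) ` T" by blast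
  qed
  then have "card {d. d dvd n} \<le> card (int ` T \<union> (\<lambda>d. - int d) ` T)"
    using fin by (intro card_mono) auto
  also have "\<dots> \<le> card (int ` T) + card ((\<lambda>d. - int d) ` T)"
    by (rule card_Un_le)
  also have "\<dots> \<le> card T + card T"
    using fin by (intro add_mono card_image_le)
  finally show ?thesis by (simp add: T_def)
qed

text \<open>
  The multiple \<open>4 N\<^sup>2\<close> accommodates products of two integers of modulus at most \<open>2 N\<close>, which occur
  for two pairs of points.
\<close>

lemma ex_divisors_at_most:
  fixes \<delta> :: real
  assumes \<delta>: "\<delta> > 0"
  shows "\<exists>C\<ge>0. \<forall>N\<ge>1. \<exists>D\<ge>1. divisors_at_most D (4 * int N * int N) \<and> real D \<le> C * real N powr \<delta>"
proof -
  obtain C where C: "\<And>n::nat. n > 0 \<Longrightarrow> real (card {d. d dvd n}) \<le> C * real n powr (\<delta> / 2)"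
    using divisor_bound[of "\<delta> / 2"] \<delta> by auto
  have C0: "C \<ge> 1" using C[of 1] by simp
  define C' where "C' = 2 * C * 4 powr (\<delta> / 2) + 1"
  have "\<exists>D\<ge>1. divisors_at_most D (4 * int N * int N) \<and> real D \<le> C' * real N powr \<delta>" if N: "N \<ge> 1" for N
  proof -
    define R where "R = 2 * C * real (4 * N * N) powr (\<delta> / 2)"
    have "real (4 * N * N) powr (\<delta> / 2) = 4 powr (\<delta> / 2) * (real N powr (\<delta> / 2) * real N powr (\<delta> / 2))"
      by (simp add: powr_mult)
    also have "\<dots> = 4 powr (\<delta> / 2) * real N powr \<delta>"
      by (simp flip: powr_add)
    finally have R: "R = 2 * C * 4 powr (\<delta> / 2) * real N powr \<delta>" by (simp add: R_def)
    have R0: "R \<ge> 0" using C0 by (simp add: R_def)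
    have "divisors_at_most (nat \<lfloor>R\<rfloor> + 1) (4 * int N * int N)"
      unfolding divisors_at_most_def
    proof (intro allI impI)
      fix n :: int assume n: "n \<noteq> 0" "\<bar>n\<bar> \<le> 4 * int N * int N"
      have "real (nat \<bar>n\<bar>) \<le> real (4 * N * N)"
        using n(2) by (simp only: of_nat_le_iff nat_le_iff) simp
      then have "C * real (nat \<bar>n\<bar>) powr (\<delta> / 2) \<le> C * real (4 * N * N) powr (\<delta> / 2)"
        using C0 \<delta> by (intro mult_left_mono powr_mono2) auto
      moreover have "real (card {d. d dvd nat \<bar>n\<bar>}) \<le> C * real (nat \<bar>n\<bar>) powr (\<delta> / 2)"
        by (rule C) (use n in simp)
      moreover have "real (card {d. d dvd n}) \<le> 2 * real (card {d. d dvd nat \<bar>n\<bar>})"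
        using card_int_divisors_le[OF n(1)] by linarith
      ultimately have "real (card {d. d dvd n}) \<le> R" by (simp add: R_def)
      then show "card {d. d dvd n} \<le> nat \<lfloor>R\<rfloor> + 1" by (intro trans_le_add1 le_nat_floor)
    qed
    moreover have "1 \<le> real N powr \<delta>" using N \<delta> by (simp add: ge_one_powr_ge_zero)
    then have "R + 1 \<le> C' * real N powr \<delta>"
      unfolding R C'_def by (simp add: distrib_right)
    then have "real (nat \<lfloor>R\<rfloor> + 1) \<le> C' * real N powr \<delta>"
      using of_nat_floor[OF R0] by simp
    ultimately show ?thesis by (intro exI[of _ "nat \<lfloor>R\<rfloor> + 1"]) simp
  qed
  moreover have "C' \<ge> 0" using C0 by (simp add: C'_def)
  ultimately show ?thesis by blast
qed

section \<open>The equation pu + qv = m in a box\<close>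

text \<open>
  All counts below have this shape: a solution is reconstructed by \<open>h\<close> from some free parameters \<open>k\<close>
  and a member of a set \<open>F k\<close> whose size is controlled uniformly. Only surjectivity of the
  reconstruction is used, so the parameters may be redundant.
\<close>

lemma card_cover:
  assumes "S \<subseteq> (\<Union>k\<in>B. h k ` F k)" "finite B" "\<And>k. k \<in> B \<Longrightarrow> finite (F k)"
    and "\<And>k. k \<in> B \<Longrightarrow> card (F k) \<le> c"
  shows "card S \<le> card B * c"
proof -
  have "card S \<le> card (\<Union>k\<in>B. h k ` F k)"
    using assms by (intro card_mono) auto
  also have "\<dots> \<le> (\<Sum>k\<in>B. card (h k ` F k))"
    by (rule card_UN_le[OF assms(2)])
  also have "\<dots> \<le> (\<Sum>k\<in>B. c)"
    using assms by (intro sum_mono) (meson card_image_le le_trans)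
  finally show ?thesis by simp
qed

definition bilinear_solutions :: "int \<Rightarrow> int \<Rightarrow> (int \<times> int \<times> int \<times> int) set" where
  "bilinear_solutions L m = {(p, q, u, v).
     p \<in> {-L..L} \<and> q \<in> {-L..L} \<and> u \<in> {-L..L} \<and> v \<in> {-L..L} \<and> p * u + q * v = m}"

lemma finite_bilinear_solutions: "finite (bilinear_solutions L m)"
  by (rule finite_subset[of _ "{-L..L} \<times> {-L..L} \<times> {-L..L} \<times> {-L..L}"])
    (auto simp: bilinear_solutions_def)

text \<open>
  For \<open>m = 0\<close> the hyperbola degenerates to two lines, so no bound better than linear in \<open>L\<close> holds
  uniformly in \<open>m\<close>.
\<close>

lemma card_hyperbola:
  fixes L m :: int
  assumes "L \<ge> 0"
  shows "card {(p, u). p \<in> {-L..L} \<and> u \<in> {-L..L} \<and> p * u = m} \<le> 2 * nat (2 * L + 1)"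
proof -
  have "{(p, u). p \<in> {-L..L} \<and> u \<in> {-L..L} \<and> p * u = m} \<subseteq>
      Pair 0 ` {-L..L} \<union> (\<lambda>p. (p, m div p)) ` {-L..L}"
    by (auto simp: image_iff)
  then have "card {(p, u). p \<in> {-L..L} \<and> u \<in> {-L..L} \<and> p * u = m} \<le>
      card (Pair (0::int) ` {-L..L} \<union> (\<lambda>p. (p, m div p)) ` {-L..L})"
    by (intro card_mono) auto
  also have "\<dots> \<le> card (Pair (0::int) ` {-L..L}) + card ((\<lambda>p. (p, m div p)) ` {-L..L})"
    by (rule card_Un_le)
  also have "\<dots> \<le> card {-L..L} + card {-L..L}"
    by (intro add_mono card_image_le) auto
  finally show ?thesis by simp
qed

text \<open>
  Solutions with \<open>p u \<noteq> 0\<close> are determined by \<open>q\<close>, \<open>v\<close> and the divisor \<open>p\<close> of \<open>m - q v\<close>; note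
  that \<open>m - q v = p u\<close> is at most \<open>L\<^sup>2\<close> in modulus whatever the size of \<open>m\<close>. Solutions with \<open>p u = 0\<close>
  satisfy \<open>q v = m\<close>, so they come from two hyperbolas.
\<close>

lemma card_bilinear_solutions:
  assumes L: "L \<ge> 0" and D: "divisors_at_most D (L * L)"
  shows "card (bilinear_solutions L m) \<le> (D + 4) * (nat (2 * L + 1))\<^sup>2"
proof -
  define I where "I = {-L..L}"
  define H where "H = (\<lambda>m. {(p, u). p \<in> I \<and> u \<in> I \<and> p * u = m})"
  define G where "G = {(p, q, u, v) \<in> bilinear_solutions L m. p * u \<noteq> 0}"
  define F where "F = (\<lambda>(q, v). {p. p dvd m - q * v \<and> m - q * v \<noteq> 0 \<and> \<bar>m - q * v\<bar> \<le> L * L})"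
  have cI: "card I = nat (2 * L + 1)" "finite I" by (auto simp: I_def)
  have fH: "finite (H k)" for k
    by (rule finite_subset[of _ "I \<times> I"]) (auto simp: H_def I_def)
  have cH: "card (H k) \<le> 2 * nat (2 * L + 1)" for k
    unfolding H_def I_def by (rule card_hyperbola[OF L])
  have "card G \<le> card (I \<times> I) * D"
  proof (rule card_cover[where h = "\<lambda>(q, v) p. (p, q, (m - q * v) div p, v)" and F = F])
    show "G \<subseteq> (\<Union>k\<in>I \<times> I. (case k of (q, v) \<Rightarrow> \<lambda>p. (p, q, (m - q * v) div p, v)) ` F k)"
    proof clarify
      fix p q u v assume "(p, q, u, v) \<in> G"
      then have *: "p \<in> I" "q \<in> I" "u \<in> I" "v \<in> I" "p * u + q * v = m" "p * u \<noteq> 0"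
        by (auto simp: G_def bilinear_solutions_def I_def)
      have e: "m - q * v = p * u" using * by simp
      have "\<bar>p * u\<bar> \<le> L * L"
        using * L unfolding abs_mult I_def by (intro mult_mono) auto
      moreover have ne: "m \<noteq> q * v" "p \<noteq> 0" using *(5,6) by auto
      ultimately have "p \<in> F (q, v)" by (simp add: F_def e)
      moreover have "(p, q, u, v) = (case (q, v) of (q, v) \<Rightarrow> \<lambda>p. (p, q, (m - q * v) div p, v)) p"
        using ne by (simp add: e)
      ultimately show "(p, q, u, v) \<in> (\<Union>k\<in>I \<times> I. (case k of (q, v) \<Rightarrow> \<lambda>p. (p, q, (m - q * v) div p, v)) ` F k)"
        using * by blast
    qed
    show "finite (F k)" "card (F k) \<le> D" for k
      unfolding F_def by (cases k; simp only: prod.case divisors_at_mostD[OF D])+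
  qed (use cI in auto)
  moreover have "card (bilinear_solutions L m - G) \<le> card (H 0 \<times> H m) * 1"
  proof (rule card_cover[where h = "\<lambda>k (_::unit). case k of ((p, u), (q, v)) \<Rightarrow> (p, q, u, v)"
        and F = "\<lambda>_. UNIV"])
    show "bilinear_solutions L m - G \<subseteq>
      (\<Union>k\<in>H 0 \<times> H m. (\<lambda>_::unit. case k of ((p, u), (q, v)) \<Rightarrow> (p, q, u, v)) ` UNIV)"
      by (auto simp: G_def H_def bilinear_solutions_def I_def)
  qed (use fH in auto)
  moreover have "card (H 0 \<times> H m) \<le> 4 * (nat (2 * L + 1))\<^sup>2"
    using mult_mono[OF cH[of 0] cH[of m]] by (simp add: card_cartesian_product power2_eq_square)
  moreover have "card (bilinear_solutions L m) \<le> card G + card (bilinear_solutions L m - G)"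
  proof -
    have "G \<subseteq> bilinear_solutions L m" by (auto simp: G_def)
    then show ?thesis
      using finite_bilinear_solutions by (metis card_Un_le Un_Diff_cancel Un_absorb1)
  qed
  ultimately show ?thesis
    by (simp add: card_cartesian_product cI power2_eq_square algebra_simps)
qed

lemma card_bilinear_solutions_nat:
  assumes D: "divisors_at_most D (int M * int M)" and "D \<ge> 1" "M \<ge> 1"
  shows "card (bilinear_solutions (int M) m) \<le> 45 * D * M\<^sup>2"
proof -
  have "nat (2 * int M + 1) = 2 * M + 1" by simp
  then have "card (bilinear_solutions (int M) m) \<le> (D + 4) * (2 * M + 1)\<^sup>2"
    using card_bilinear_solutions[OF _ D, of m] by (simp only: of_nat_0_le_iff)
  also have "\<dots> \<le> (5 * D) * (3 * M)\<^sup>2"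
    using assms by (intro mult_mono power_mono) auto
  finally show ?thesis by (simp add: power_mult_distrib)
qed

section \<open>Additive energy of the surface\<close>

definition energy :: "('a \<Rightarrow> 'b) \<Rightarrow> 'a set \<Rightarrow> nat" where
  "energy f A = card {(a, b). a \<in> A \<and> b \<in> A \<and> f a = f b}"

text \<open>
  Let \<open>r v\<close> be the number of \<open>a \<in> A\<close> with \<open>f a = v\<close>. The shifted count is the correlation of \<open>r\<close> with
  a translate of itself, at most the sum of \<open>r\<^sup>2\<close> by \<open>2 \<alpha> \<beta> \<le> \<alpha>\<^sup>2 + \<beta>\<^sup>2\<close>.
\<close>

lemma energy_shift:
  fixes f :: "'a \<Rightarrow> 'b::ab_group_add"
  assumes fin: "finite A"
  shows "card {(a, b). a \<in> A \<and> b \<in> A \<and> f a = f b + m} \<le> energy f A"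
proof -
  define r where "r = (\<lambda>v. card {a \<in> A. f a = v})"
  have count: "card {(a, b). a \<in> A \<and> b \<in> A \<and> f a = f b + m} = (\<Sum>v\<in>f ` A. r (v + m) * r v)" for m
  proof -
    have "{(a, b). a \<in> A \<and> b \<in> A \<and> f a = f b + m} =
        (\<Union>v\<in>f ` A. {a \<in> A. f a = v + m} \<times> {a \<in> A. f a = v})"
      by auto
    also have "card \<dots> = (\<Sum>v\<in>f ` A. r (v + m) * r v)"
      unfolding r_def card_cartesian_product[symmetric]
      using fin by (intro card_UN_disjoint) auto
    finally show ?thesis .
  qed
  have "(\<Sum>v\<in>f ` A. (r (v + m))\<^sup>2) = (\<Sum>w\<in>(\<lambda>v. v + m) ` f ` A. (r w)\<^sup>2)"
    by (simp add: sum.reindex)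
  also have "\<dots> = (\<Sum>w\<in>((\<lambda>v. v + m) ` f ` A) \<inter> f ` A. (r w)\<^sup>2)"
  proof (rule sum.mono_neutral_right)
    have "r w = 0" if "w \<notin> f ` A" for w
    proof -
      have "{a \<in> A. f a = w} = {}" using that by auto
      then show ?thesis by (simp only: r_def card.empty)
    qed
    then show "\<forall>i\<in>(\<lambda>v. v + m) ` f ` A - (\<lambda>v. v + m) ` f ` A \<inter> f ` A. (r i)\<^sup>2 = 0"
      by auto
  qed (use fin in auto)
  also have "\<dots> \<le> (\<Sum>w\<in>f ` A. (r w)\<^sup>2)"
    using fin by (intro sum_mono2) auto
  finally have le: "(\<Sum>v\<in>f ` A. (r (v + m))\<^sup>2) \<le> (\<Sum>w\<in>f ` A. (r w)\<^sup>2)" .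
  have "2 * (\<Sum>v\<in>f ` A. r (v + m) * r v) \<le> (\<Sum>v\<in>f ` A. (r (v + m))\<^sup>2 + (r v)\<^sup>2)"
    unfolding sum_distrib_left
  proof (rule sum_mono)
    fix v
    have "0 \<le> (int (r (v + m)) - int (r v))\<^sup>2" by simp
    then have "int (2 * (r (v + m) * r v)) \<le> int ((r (v + m))\<^sup>2 + (r v)\<^sup>2)"
      by (simp add: power2_diff)
    then show "2 * (r (v + m) * r v) \<le> (r (v + m))\<^sup>2 + (r v)\<^sup>2"
      by (simp only: of_nat_le_iff)
  qed
  also have "\<dots> \<le> 2 * (\<Sum>v\<in>f ` A. (r v)\<^sup>2)"
    using le by (simp add: sum.distrib)
  finally have "(\<Sum>v\<in>f ` A. r (v + m) * r v) \<le> (\<Sum>v\<in>f ` A. r (v + 0) * r v)"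
    by (simp add: power2_eq_square)
  then show ?thesis
    using count[of m] count[of 0] by (simp add: energy_def)
qed

definition form_point :: "int \<times> int \<times> int \<Rightarrow> int \<times> int \<times> int \<times> int \<times> int" where
  "form_point = (\<lambda>(x, y, z). (x, y, z, x\<^sup>2, y\<^sup>2 + x * z))"

definition form_sum :: "(int \<times> int \<times> int) list \<Rightarrow> int \<times> int \<times> int \<times> int \<times> int" where
  "form_sum l = sum_list (map form_point l)"

definition cube :: "nat \<Rightarrow> (int \<times> int \<times> int) set" where
  "cube N = {0..int N} \<times> {0..int N} \<times> {0..int N}"

definition tuples :: "nat \<Rightarrow> nat \<Rightarrow> (int \<times> int \<times> int) list set" where
  "tuples s N = {l. length l = s \<and> set l \<subseteq> cube N}"

lemma finite_cube: "finite (cube N)"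
  by (simp add: cube_def)

lemma card_cube: "card (cube N) = (N + 1) ^ 3"
proof -
  have "card {0..int N} = N + 1" by simp
  then show ?thesis
    by (simp only: cube_def card_cartesian_product power3_eq_cube mult.assoc)
qed

lemma finite_tuples: "finite (tuples s N)"
  using finite_lists_length_eq[OF finite_cube] by (simp add: tuples_def conj_commute)

text \<open>
  The leading points \<open>p\<close> and \<open>q\<close> of the two tuples are fixed; the remaining points then solve a
  shifted system.
\<close>

lemma energy_Suc:
  "energy form_sum (tuples (Suc s) N) \<le> ((N + 1) ^ 3)\<^sup>2 * energy form_sum (tuples s N)"
proof -
  define F where "F = (\<lambda>(p, q). {(a, b). a \<in> tuples s N \<and> b \<in> tuples s N \<and>
      form_sum a = form_sum b + (form_point q - form_point p)})"
  have "energy form_sum (tuples (Suc s) N) \<le> card (cube N \<times> cube N) * energy form_sum (tuples s N)"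
    unfolding energy_def[of form_sum "tuples (Suc s) N"]
  proof (rule card_cover[where F = F and h = "\<lambda>(p, q) (a, b). (p # a, q # b)"])
    show "{(a, b). a \<in> tuples (Suc s) N \<and> b \<in> tuples (Suc s) N \<and> form_sum a = form_sum b}
      \<subseteq> (\<Union>k\<in>cube N \<times> cube N. (case k of (p, q) \<Rightarrow> \<lambda>(a, b). (p # a, q # b)) ` F k)"
    proof clarify
      fix l l' assume l: "l \<in> tuples (Suc s) N" "l' \<in> tuples (Suc s) N" "form_sum l = form_sum l'"
      obtain p a where a: "l = p # a" using l(1) by (cases l) (auto simp: tuples_def)
      obtain q b where b: "l' = q # b" using l(2) by (cases l') (auto simp: tuples_def)
      have "form_point p + form_sum a = form_point q + form_sum b"
        using l(3) by (simp add: a b form_sum_def)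
      then have "(a, b) \<in> F (p, q)"
        using l by (auto simp: F_def a b tuples_def algebra_simps)
      moreover have "(p, q) \<in> cube N \<times> cube N"
        using l by (auto simp: a b tuples_def)
      ultimately show "(l, l') \<in> (\<Union>k\<in>cube N \<times> cube N. (case k of (p, q) \<Rightarrow> \<lambda>(a, b). (p # a, q # b)) ` F k)"
        unfolding a b by force
    qed
    show "finite (F k)" for k
      by (rule finite_subset[of _ "tuples s N \<times> tuples s N"])
        (use finite_tuples in \<open>auto simp: F_def\<close>)
    show "card (F k) \<le> energy form_sum (tuples s N)" for k
      unfolding F_def by (cases k) (use energy_shift[OF finite_tuples] in auto)
  qed (use finite_cube in auto)
  then show ?thesis
    by (simp add: card_cartesian_product card_cube power2_eq_square)
qed

lemma J_le_energy: "J s N \<le> energy form_sum (tuples s N)"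
  unfolding J_def energy_def
proof (rule card_inj_on_le)
  define pt where "pt = (\<lambda>(x, y, z) (i::nat). (int (x i), int (y i), int (z i)))"
  define g where "g = (\<lambda>t. (map (pt t) [1..<s + 1], map (pt t) [s + 1..<2 * s + 1]))"
  have sum_tuple: "sum_list (map (\<lambda>i. (a i, b i, c i, d i, e i)) xs) =
      (sum_list (map a xs), sum_list (map b xs), sum_list (map c xs), sum_list (map d xs),
        sum_list (map e xs))" for a b c d e :: "nat \<Rightarrow> int" and xs
    by (induction xs) (auto simp: zero_prod_def)
  show "inj_on g (solutions s N)"
  proof (rule inj_onI)
    fix t t' assume t: "t \<in> solutions s N" "t' \<in> solutions s N" "g t = g t'"
    obtain x y z x' y' z' where e: "t = (x, y, z)" "t' = (x', y', z')"
      by (metis surj_pair)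
    have eq: "pt t i = pt t' i" if "i \<in> {1..2 * s}" for i
    proof (cases "i \<le> s")
      case True
      then have "i \<in> set [1..<s + 1]" using that by auto
      then show ?thesis using t(3) by (simp add: g_def del: upt_Suc set_upt)
    next
      case False
      then have "i \<in> set [s + 1..<2 * s + 1]" using that by auto
      then show ?thesis using t(3) by (simp add: g_def del: upt_Suc set_upt)
    qed
    have "x \<in> {1..2 * s} \<rightarrow>\<^sub>E {0..N}" "x' \<in> {1..2 * s} \<rightarrow>\<^sub>E {0..N}"
      "y \<in> {1..2 * s} \<rightarrow>\<^sub>E {0..N}" "y' \<in> {1..2 * s} \<rightarrow>\<^sub>E {0..N}"
      "z \<in> {1..2 * s} \<rightarrow>\<^sub>E {0..N}" "z' \<in> {1..2 * s} \<rightarrow>\<^sub>E {0..N}"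
      using t by (auto simp: e solutions_def)
    moreover have "x i = x' i" "y i = y' i" "z i = z' i" if "i \<in> {1..2 * s}" for i
      using eq[OF that] by (auto simp: e pt_def)
    ultimately show "t = t'"
      unfolding e by (metis PiE_ext)
  qed
  show "g ` solutions s N \<subseteq> {(a, b). a \<in> tuples s N \<and> b \<in> tuples s N \<and> form_sum a = form_sum b}"
  proof (rule image_subsetI)
    fix t assume t: "t \<in> solutions s N"
    obtain x y z where e: "t = (x, y, z)" by (metis surj_pair)
    have upt: "sum_list (map f [Suc a..<Suc b]) = (\<Sum>i = Suc a..b. f i)" for f :: "nat \<Rightarrow> int" and a b
      by (simp add: interv_sum_list_conv_sum_set_nat atLeastLessThanSuc_atLeastAtMost del: upt_Suc)
    have val: "form_sum (map (pt t) [a + 1..<b + 1]) =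
       (int (\<Sum>i = a + 1..b. x i), int (\<Sum>i = a + 1..b. y i), int (\<Sum>i = a + 1..b. z i),
        int (\<Sum>i = a + 1..b. (x i)\<^sup>2), int (\<Sum>i = a + 1..b. (y i)\<^sup>2 + x i * z i))" for a b
      unfolding form_sum_def map_map
      by (simp add: e pt_def form_point_def comp_def sum_tuple upt del: upt_Suc)
    have "form_sum (fst (g t)) = form_sum (snd (g t))"
      using t val[of 0 s] val[of s "2 * s"] by (simp add: g_def e solutions_def del: upt_Suc)
    moreover have "pt t i \<in> cube N" if "i \<in> {1..2 * s}" for i
      using t that by (auto simp: e pt_def solutions_def cube_def PiE_iff)
    then have "fst (g t) \<in> tuples s N" "snd (g t) \<in> tuples s N"
      by (auto simp: g_def tuples_def simp del: upt_Suc)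
    ultimately show "g t \<in> {(a, b). a \<in> tuples s N \<and> b \<in> tuples s N \<and> form_sum a = form_sum b}"
      by (simp add: case_prod_beta)
  qed
  show "finite {(a, b). a \<in> tuples s N \<and> b \<in> tuples s N \<and> form_sum a = form_sum b}"
    by (rule finite_subset[of _ "tuples s N \<times> tuples s N"]) (use finite_tuples in auto)
qed

lemma energy_add:
  assumes "N \<ge> 1"
  shows "energy form_sum (tuples (s + k) N) \<le> 64 ^ k * N ^ (6 * k) * energy form_sum (tuples s N)"
proof (induction k)
  case (Suc k)
  have "((N + 1) ^ 3)\<^sup>2 \<le> ((2 * N) ^ 3)\<^sup>2"
    using assms by (intro power_mono) auto
  also have "\<dots> = 64 * N ^ 6"
    by (simp add: power_mult_distrib flip: power_mult)
  finally have c: "((N + 1) ^ 3)\<^sup>2 \<le> 64 * N ^ 6" .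
  have "energy form_sum (tuples (s + Suc k) N) \<le> ((N + 1) ^ 3)\<^sup>2 * energy form_sum (tuples (s + k) N)"
    using energy_Suc[of "s + k" N] by simp
  also have "\<dots> \<le> (64 * N ^ 6) * (64 ^ k * N ^ (6 * k) * energy form_sum (tuples s N))"
    using c Suc.IH by (intro mult_mono) auto
  finally show ?case by (simp add: power_add mult_ac)
qed simp

section \<open>One and two pairs of points\<close>

lemma two_squares_rigid:
  fixes a b c d :: int
  assumes "a + b = c + d" "a\<^sup>2 + b\<^sup>2 = c\<^sup>2 + d\<^sup>2"
  shows "a = c \<and> b = d \<or> a = d \<and> b = c"
proof -
  have "(a - c) * (a - d) = 0"
    using assms by algebra
  then show ?thesis using assms by auto
qed

lemma energy_1: "energy form_sum (tuples 1 N) \<le> (N + 1) ^ 3"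
proof -
  have "energy form_sum (tuples 1 N) \<le> card (cube N) * 1"
    unfolding energy_def
  proof (rule card_cover[where h = "\<lambda>p _. ([p], [p])" and F = "\<lambda>_. {()}"])
    show "{(a, b). a \<in> tuples 1 N \<and> b \<in> tuples 1 N \<and> form_sum a = form_sum b}
      \<subseteq> (\<Union>p\<in>cube N. (\<lambda>_. ([p], [p])) ` {()})"
      by (auto simp: tuples_def length_Suc_conv form_sum_def form_point_def zero_prod_def)
  qed (auto simp: finite_cube)
  then show ?thesis by (simp add: card_cube)
qed

lemma card_box4: "card ({0..int N} \<times> {0..int N} \<times> {0..int N} \<times> {0..int N}) = (N + 1) ^ 4"
proof -
  have "card {0..int N} = N + 1" by simp
  then show ?thesis
    by (simp only: card_cartesian_product power4_eq_xxxx mult.assoc)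
qed

text \<open>
  The flag \<open>\<sigma>\<close> records which of \<open>x\<^sub>3, x\<^sub>4\<close> equals \<open>x\<^sub>1\<close>. The box of side \<open>2 N\<close> is needed because the
  coefficient 2 in \<open>2 (y\<^sub>1 - y\<^sub>3) (y\<^sub>3 - y\<^sub>2)\<close> is absorbed into one variable.
\<close>

lemma energy_2:
  "energy form_sum (tuples 2 N) \<le> 2 * (N + 1) ^ 4 * card (bilinear_solutions (2 * int N) 0)"
proof -
  define I where "I = {0..int N}"
  define B where "B = (UNIV :: bool set) \<times> I \<times> I \<times> I \<times> I"
  define K where "K = bilinear_solutions (2 * int N) 0"
  define h :: "bool \<times> int \<times> int \<times> int \<times> int \<Rightarrow> int \<times> int \<times> int \<times> int
      \<Rightarrow> (int \<times> int \<times> int) list \<times> (int \<times> int \<times> int) list"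
    where "h = (\<lambda>(\<sigma>, b, y1, z1, z2) (p, q, u, v).
      let y3 = y1 - q div 2; y2 = y3 - v; y4 = y1 + y2 - y3; z3 = z1 - u; z4 = z1 + z2 - z3;
          P = (b + p, y3, z3); Q = (b, y4, z4)
      in ([(b + p, y1, z1), (b, y2, z2)], if \<sigma> then [P, Q] else [Q, P]))"
  have key: "([(a, y1, z1), (b, y2, z2)], if \<sigma> then [(a, y3, z3), (b, y4, z4)] else [(b, y4, z4), (a, y3, z3)])
      \<in> (\<Union>k\<in>B. h k ` K)"
    if I: "a \<in> I" "b \<in> I" "y1 \<in> I" "y2 \<in> I" "y3 \<in> I" "z1 \<in> I" "z2 \<in> I" "z3 \<in> I"
      and y: "y1 + y2 = y3 + y4" and z: "z1 + z2 = z3 + z4"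
      and q: "y1\<^sup>2 + a * z1 + (y2\<^sup>2 + b * z2) = y3\<^sup>2 + a * z3 + (y4\<^sup>2 + b * z4)"
    for \<sigma> a b y1 y2 y3 y4 z1 z2 z3 z4
  proof -
    have e: "y4 = y1 + y2 - y3" "z4 = z1 + z2 - z3" using y z by auto
    \<comment> \<open>With \<open>x\<close> equal on both sides, \<open>y\<^sub>1\<^sup>2 + y\<^sub>2\<^sup>2 - y\<^sub>3\<^sup>2 - y\<^sub>4\<^sup>2\<close> factors because \<open>y\<^sub>4 = y\<^sub>1 + y\<^sub>2 - y\<^sub>3\<close>.\<close>
    have "(a - b) * (z1 - z3) + 2 * (y1 - y3) * (y3 - y2) = 0"
      using q unfolding e by algebra
    then have "(a - b, 2 * (y1 - y3), z1 - z3, y3 - y2) \<in> K"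
      using I unfolding I_def by (auto simp: K_def bilinear_solutions_def)
    moreover have "(\<sigma>, b, y1, z1, z2) \<in> B" using I by (simp add: B_def)
    moreover have "([(a, y1, z1), (b, y2, z2)], if \<sigma> then [(a, y3, z3), (b, y4, z4)] else [(b, y4, z4), (a, y3, z3)])
      = h (\<sigma>, b, y1, z1, z2) (a - b, 2 * (y1 - y3), z1 - z3, y3 - y2)"
      by (simp add: h_def e)
    ultimately show ?thesis by blast
  qed
  have "energy form_sum (tuples 2 N) \<le> card B * card K"
    unfolding energy_def
  proof (rule card_cover[where h = h and F = "\<lambda>_. K"])
    show "{(a, b). a \<in> tuples 2 N \<and> b \<in> tuples 2 N \<and> form_sum a = form_sum b} \<subseteq> (\<Union>k\<in>B. h k ` K)"
    proof clarify
      fix l l' assume l: "l \<in> tuples 2 N" "l' \<in> tuples 2 N" and eq: "form_sum l = form_sum l'"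
      obtain x1 y1 z1 x2 y2 z2 where e: "l = [(x1, y1, z1), (x2, y2, z2)]"
        using l(1) by (auto simp: tuples_def numeral_2_eq_2 length_Suc_conv)
      obtain x3 y3 z3 x4 y4 z4 where e': "l' = [(x3, y3, z3), (x4, y4, z4)]"
        using l(2) by (auto simp: tuples_def numeral_2_eq_2 length_Suc_conv)
      have I: "x1 \<in> I" "y1 \<in> I" "z1 \<in> I" "x2 \<in> I" "y2 \<in> I" "z2 \<in> I"
        "x3 \<in> I" "y3 \<in> I" "z3 \<in> I" "x4 \<in> I" "y4 \<in> I" "z4 \<in> I"
        using l by (auto simp: e e' tuples_def cube_def I_def)
      have eqs: "x1 + x2 = x3 + x4" "y1 + y2 = y3 + y4" "z1 + z2 = z3 + z4"
        "x1\<^sup>2 + x2\<^sup>2 = x3\<^sup>2 + x4\<^sup>2"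
        "y1\<^sup>2 + x1 * z1 + (y2\<^sup>2 + x2 * z2) = y3\<^sup>2 + x3 * z3 + (y4\<^sup>2 + x4 * z4)"
        using eq by (auto simp: e e' form_sum_def form_point_def zero_prod_def)
      from two_squares_rigid[OF eqs(1,4)]
      show "(l, l') \<in> (\<Union>k\<in>B. h k ` K)"
      proof
        assume "x1 = x3 \<and> x2 = x4"
        then show ?thesis
          using key[of x1 x2 y1 y2 y3 z1 z2 z3 y4 z4 True] I eqs by (simp add: e e')
      next
        assume "x1 = x4 \<and> x2 = x3"
        then show ?thesis
          using key[of x1 x2 y1 y2 y4 z1 z2 z4 y3 z3 False] I eqs by (simp add: e e' ac_simps)
      qed
    qed
  qed (auto simp: B_def I_def K_def finite_bilinear_solutions)
  also have "card B = 2 * (N + 1) ^ 4"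
    unfolding B_def I_def card_cartesian_product[of UNIV] card_box4 by simp
  finally show ?thesis by (simp add: K_def)
qed

lemma energy_2_le:
  assumes D: "divisors_at_most D (4 * int N * int N)" and "D \<ge> 1" "N \<ge> 1"
  shows "energy form_sum (tuples 2 N) \<le> 5760 * D * N ^ 6"
proof -
  have "card (bilinear_solutions (2 * int N) 0) \<le> 45 * D * (2 * N)\<^sup>2"
    using card_bilinear_solutions_nat[of D "2 * N" 0] assms by (simp add: mult.assoc)
  then have "2 * (N + 1) ^ 4 * card (bilinear_solutions (2 * int N) 0)
      \<le> 2 * (2 * N) ^ 4 * (45 * D * (2 * N)\<^sup>2)"
    using assms by (intro mult_mono power_mono) auto
  also have "\<dots> = 5760 * D * N ^ 6"
    by (simp add: power_mult_distrib flip: power_add)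
  finally show ?thesis using energy_2 le_trans by blast
qed

section \<open>Three pairs of points\<close>

text \<open>
  The system for three pairs of points after the values of \<open>y\<close> have been fixed: they enter only
  through the constant \<open>m\<close>.
\<close>

definition twisted_solutions ::
  "int \<Rightarrow> int \<Rightarrow> ((int \<times> int \<times> int \<times> int \<times> int \<times> int) \<times> (int \<times> int \<times> int \<times> int \<times> int \<times> int)) set" where
  "twisted_solutions N m = {((x1, x2, x3, x4, x5, x6), (z1, z2, z3, z4, z5, z6)).
     {x1, x2, x3, x4, x5, x6, z1, z2, z3, z4, z5, z6} \<subseteq> {0..N} \<and>
     x1 + x2 + x3 = x4 + x5 + x6 \<and> x1\<^sup>2 + x2\<^sup>2 + x3\<^sup>2 = x4\<^sup>2 + x5\<^sup>2 + x6\<^sup>2 \<and>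
     z1 + z2 + z3 = z4 + z5 + z6 \<and>
     x1 * z1 + x2 * z2 + x3 * z3 - (x4 * z4 + x5 * z5 + x6 * z6) = m}"

lemma finite_twisted_solutions: "finite (twisted_solutions N m)"
proof (rule finite_subset)
  let ?I = "{0..N}"
  let ?B = "?I \<times> ?I \<times> ?I \<times> ?I \<times> ?I \<times> ?I"
  show "twisted_solutions N m \<subseteq> ?B \<times> ?B"
    by (auto simp: twisted_solutions_def)
  show "finite (?B \<times> ?B)" by simp
qed

text \<open>
  If \<open>x\<^sub>6\<close> cancels against one of \<open>x\<^sub>1, x\<^sub>2, x\<^sub>3\<close>, two variables remain on either side and
  \<open>two_squares_rigid\<close> makes \<open>(x\<^sub>4, x\<^sub>5, x\<^sub>6)\<close> one of the six permutations of \<open>(x\<^sub>1, x\<^sub>2, x\<^sub>3)\<close>. Permuting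
  \<open>z\<^sub>4, z\<^sub>5, z\<^sub>6\<close> accordingly reduces to \<open>(x\<^sub>4, x\<^sub>5, x\<^sub>6) = (x\<^sub>1, x\<^sub>2, x\<^sub>3)\<close>. There, eliminating \<open>z\<^sub>6\<close> turns the
  last equation into \<open>(x\<^sub>1 - x\<^sub>3) (z\<^sub>1 - z\<^sub>4) + (x\<^sub>2 - x\<^sub>3) (z\<^sub>2 - z\<^sub>5) = m\<close>.
\<close>

lemma card_twisted_solutions_diagonal:
  "card {((x1, x2, x3, x4, x5, x6), z) \<in> twisted_solutions (int N) m. x6 \<in> {x1, x2, x3}}
    \<le> 6 * (N + 1) ^ 4 * card (bilinear_solutions (int N) m)"
proof -
  define I where "I = {0..int N}"
  define K where "K = bilinear_solutions (int N) m"
  define perm :: "nat \<Rightarrow> int \<times> int \<times> int \<Rightarrow> int \<times> int \<times> int" where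
    "perm = (\<lambda>\<sigma> (a, b, c). [(a, b, c), (a, c, b), (b, a, c), (b, c, a), (c, a, b), (c, b, a)] ! \<sigma>)"
  define h :: "nat \<times> int \<times> int \<times> int \<times> int \<Rightarrow> int \<times> int \<times> int \<times> int \<Rightarrow>
      (int \<times> int \<times> int \<times> int \<times> int \<times> int) \<times> (int \<times> int \<times> int \<times> int \<times> int \<times> int)" where
    "h = (\<lambda>(\<sigma>, c, z1, z2, z3) (p, q, u, v).
      ((c + p, c + q, c, perm \<sigma> (c + p, c + q, c)), (z1, z2, z3, perm \<sigma> (z1 - u, z2 - v, z3 + u + v))))"
  define B where "B = {..<6::nat} \<times> I \<times> I \<times> I \<times> I"
  define S where "S = {((x1, x2, x3, x4, x5, x6), z) \<in> twisted_solutions (int N) m. x6 \<in> {x1, x2, x3}}"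
  have key: "((a, b, c, perm \<sigma> (a, b, c)), (z1, z2, z3, perm \<sigma> (z4, z5, z6))) \<in> (\<Union>k\<in>B. h k ` K)"
    if "\<sigma> < 6" and I: "a \<in> I" "b \<in> I" "c \<in> I" "z1 \<in> I" "z2 \<in> I" "z3 \<in> I" "z4 \<in> I" "z5 \<in> I"
      and z: "z1 + z2 + z3 = z4 + z5 + z6"
      and m: "a * z1 + b * z2 + c * z3 - (a * z4 + b * z5 + c * z6) = m"
    for \<sigma> a b c z1 z2 z3 z4 z5 z6
  proof -
    have z6: "z6 = z1 + z2 + z3 - z4 - z5" using z by simp
    have "(a - c) * (z1 - z4) + (b - c) * (z2 - z5) = m"
      using m unfolding z6 by (simp add: algebra_simps)
    then have "(a - c, b - c, z1 - z4, z2 - z5) \<in> K"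
      using I by (auto simp: K_def bilinear_solutions_def I_def)
    moreover have "(\<sigma>, c, z1, z2, z3) \<in> B" using that by (simp add: B_def)
    moreover have "((a, b, c, perm \<sigma> (a, b, c)), (z1, z2, z3, perm \<sigma> (z4, z5, z6))) =
        h (\<sigma>, c, z1, z2, z3) (a - c, b - c, z1 - z4, z2 - z5)"
    proof -
      have "z6 = z3 + (z1 - z4) + (z2 - z5)" using z by simp
      then show ?thesis by (simp add: h_def)
    qed
    ultimately show ?thesis by blast
  qed
  have "card S \<le> card B * card K"
  proof (rule card_cover[where h = h and F = "\<lambda>_. K"])
    show "S \<subseteq> (\<Union>k\<in>B. h k ` K)"
    proof
      fix s assume s: "s \<in> S"
      obtain x1 x2 x3 x4 x5 x6 z1 z2 z3 z4 z5 z6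
        where e: "s = ((x1, x2, x3, x4, x5, x6), (z1, z2, z3, z4, z5, z6))"
        by (metis surj_pair)
      have I: "x1 \<in> I" "x2 \<in> I" "x3 \<in> I" "z1 \<in> I" "z2 \<in> I" "z3 \<in> I" "z4 \<in> I" "z5 \<in> I" "z6 \<in> I"
        and x: "x1 + x2 + x3 = x4 + x5 + x6" "x1\<^sup>2 + x2\<^sup>2 + x3\<^sup>2 = x4\<^sup>2 + x5\<^sup>2 + x6\<^sup>2"
        and z: "z1 + z2 + z3 = z4 + z5 + z6"
        and m: "x1 * z1 + x2 * z2 + x3 * z3 - (x4 * z4 + x5 * z5 + x6 * z6) = m"
        and d: "x6 = x1 \<or> x6 = x2 \<or> x6 = x3"
        using s by (auto simp: S_def e twisted_solutions_def I_def)
      have P: "perm 0 (a, b, c) = (a, b, c)" "perm (Suc 0) (a, b, c) = (a, c, b)"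
        "perm 2 (a, b, c) = (b, a, c)" "perm 3 (a, b, c) = (b, c, a)"
        "perm 4 (a, b, c) = (c, a, b)" "perm 5 (a, b, c) = (c, b, a)" for a b c
        by (simp_all add: perm_def)
      \<comment> \<open>In each case \<open>\<sigma>\<close> is the index of the permutation that carries \<open>(x\<^sub>1, x\<^sub>2, x\<^sub>3)\<close> to \<open>(x\<^sub>4, x\<^sub>5, x\<^sub>6)\<close>.\<close>
      from d show "s \<in> (\<Union>k\<in>B. h k ` K)"
      proof (elim disjE)
        assume 6: "x6 = x1"
        then have "x2 = x4 \<and> x3 = x5 \<or> x2 = x5 \<and> x3 = x4"
          using x by (intro two_squares_rigid) auto
        then show ?thesis
        proof
          assume "x2 = x4 \<and> x3 = x5"
          then show ?thesis
            using key[of 3 x1 x2 x3 z1 z2 z3 z6 z4 z5] 6 I z m by (simp add: P e algebra_simps)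
        next
          assume "x2 = x5 \<and> x3 = x4"
          then show ?thesis
            using key[of 5 x1 x2 x3 z1 z2 z3 z6 z5 z4] 6 I z m by (simp add: P e algebra_simps)
        qed
      next
        assume 6: "x6 = x2"
        then have "x1 = x4 \<and> x3 = x5 \<or> x1 = x5 \<and> x3 = x4"
          using x by (intro two_squares_rigid) auto
        then show ?thesis
        proof
          assume "x1 = x4 \<and> x3 = x5"
          then show ?thesis
            using key[of 1 x1 x2 x3 z1 z2 z3 z4 z6 z5] 6 I z m by (simp add: P e algebra_simps)
        next
          assume "x1 = x5 \<and> x3 = x4"
          then show ?thesis
            using key[of 4 x1 x2 x3 z1 z2 z3 z5 z6 z4] 6 I z m by (simp add: P e algebra_simps)
        qed
      next
        assume 6: "x6 = x3"
        then have "x1 = x4 \<and> x2 = x5 \<or> x1 = x5 \<and> x2 = x4"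
          using x by (intro two_squares_rigid) auto
        then show ?thesis
        proof
          assume "x1 = x4 \<and> x2 = x5"
          then show ?thesis
            using key[of 0 x1 x2 x3 z1 z2 z3 z4 z5 z6] 6 I z m by (simp add: P e algebra_simps)
        next
          assume "x1 = x5 \<and> x2 = x4"
          then show ?thesis
            using key[of 2 x1 x2 x3 z1 z2 z3 z5 z4 z6] 6 I z m by (simp add: P e algebra_simps)
        qed
      qed
    qed
  qed (auto simp: B_def I_def K_def finite_bilinear_solutions)
  also have "card B = 6 * (N + 1) ^ 4"
    unfolding B_def I_def card_cartesian_product[of "{..<6}"] card_box4 by simp
  finally show ?thesis by (simp add: S_def K_def)
qed

text \<open>
  For given \<open>x\<close> and \<open>z\<^sub>3, z\<^sub>4, z\<^sub>5\<close>, the pair \<open>(z\<^sub>1, z\<^sub>2)\<close> lies on a line with direction orthogonal to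
  \<open>(a, b) = (x\<^sub>1 - x\<^sub>6, x\<^sub>2 - x\<^sub>6)\<close>. The constant term of that line depends on all of \<open>x\<close>; measuring
  \<open>(z\<^sub>1, z\<^sub>2)\<close> from a fixed solution \<open>base\<close> removes it, and the remaining homogeneous equation involves
  \<open>a\<close>, \<open>b\<close> alone. The divisor \<open>e\<close> of \<open>a b\<close> stands for \<open>x\<^sub>4 - x\<^sub>6 - a - b\<close>.
\<close>

lemma card_twisted_solutions_off_diagonal:
  assumes D: "divisors_at_most D (int N * int N)"
  shows "card {((x1, x2, x3, x4, x5, x6), z) \<in> twisted_solutions (int N) m. x6 \<notin> {x1, x2, x3}}
    \<le> (N + 1) ^ 4 * card (bilinear_solutions (int N) 0) * D"
proof -
  define I where "I = {0..int N}"
  define K where "K = bilinear_solutions (int N) 0"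
  define good where "good = (\<lambda>(x1, x2, x3, x4, x5, x6) z3 z4 z5 (z1, z2). z1 \<in> I \<and> z2 \<in> I \<and>
     (x1 - x6) * z1 + (x2 - x6) * z2 + (x3 - x6) * z3 - (x4 - x6) * z4 - (x5 - x6) * z5 = m)"
  define base :: "int \<times> int \<times> int \<times> int \<times> int \<times> int \<Rightarrow> int \<Rightarrow> int \<Rightarrow> int \<Rightarrow> int \<times> int"
    where "base = (\<lambda>x z3 z4 z5. SOME w. good x z3 z4 z5 w)"
  define B where "B = (I \<times> I \<times> I \<times> I) \<times> K"
  define F where "F = (\<lambda>(_ :: int \<times> int \<times> int \<times> int, (a, b, _ :: int \<times> int)).
     {e :: int. e dvd a * b \<and> a * b \<noteq> 0 \<and> \<bar>a * b\<bar> \<le> int N * int N})"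
  define h :: "(int \<times> int \<times> int \<times> int) \<times> (int \<times> int \<times> int \<times> int) \<Rightarrow> int \<Rightarrow>
      (int \<times> int \<times> int \<times> int \<times> int \<times> int) \<times> (int \<times> int \<times> int \<times> int \<times> int \<times> int)" where
    "h = (\<lambda>((x6, z3, z4, z5), (a, b, w1, w2)) e.
      let x1 = x6 + a; x2 = x6 + b; x4 = x6 + (a + b) + e; x5 = x6 + (a + b) + a * b div e;
          x3 = x4 + x5 + x6 - x1 - x2; x = (x1, x2, x3, x4, x5, x6);
          z1 = fst (base x z3 z4 z5) + w1; z2 = snd (base x z3 z4 z5) + w2
      in (x, (z1, z2, z3, z4, z5, z1 + z2 + z3 - z4 - z5)))"
  define S where "S = {((x1, x2, x3, x4, x5, x6), z) \<in> twisted_solutions (int N) m. x6 \<notin> {x1, x2, x3}}"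
  have "card S \<le> card B * D"
  proof (rule card_cover[where h = h and F = F])
    show "S \<subseteq> (\<Union>k\<in>B. h k ` F k)"
    proof
      fix s assume s: "s \<in> S"
      obtain x1 x2 x3 x4 x5 x6 z1 z2 z3 z4 z5 z6
        where e: "s = ((x1, x2, x3, x4, x5, x6), (z1, z2, z3, z4, z5, z6))"
        by (metis surj_pair)
      have I: "x1 \<in> I" "x2 \<in> I" "x6 \<in> I" "z1 \<in> I" "z2 \<in> I" "z3 \<in> I" "z4 \<in> I" "z5 \<in> I"
        and x: "x1 + x2 + x3 = x4 + x5 + x6" "x1\<^sup>2 + x2\<^sup>2 + x3\<^sup>2 = x4\<^sup>2 + x5\<^sup>2 + x6\<^sup>2"
        and z: "z1 + z2 + z3 = z4 + z5 + z6"
        and m: "x1 * z1 + x2 * z2 + x3 * z3 - (x4 * z4 + x5 * z5 + x6 * z6) = m"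
        and d: "x1 - x6 \<noteq> 0" "x2 - x6 \<noteq> 0"
        using s by (auto simp: S_def e twisted_solutions_def I_def)
      define x where "x = (x1, x2, x3, x4, x5, x6)"
      define a where "a = x1 - x6"
      define b where "b = x2 - x6"
      define u where "u = x4 - x6 - (a + b)"
      define v where "v = x5 - x6 - (a + b)"
      have x3: "x3 = x4 + x5 + x6 - x1 - x2" using x by simp
      \<comment> \<open>Both equations for \<open>x\<close> are invariant under translation, so \<open>x\<^sub>6\<close> may be thought of as 0.\<close>
      have "2 * (u * v) = 2 * (a * b)"
        using x(2) unfolding x3 u_def v_def a_def b_def by algebra
      then have uv: "u * v = a * b" by simp
      have ab: "a * b \<noteq> 0" using d by (simp add: a_def b_def)
      then have "u \<noteq> 0" using uv by auto
      have v: "v = a * b div u" using uv \<open>u \<noteq> 0\<close> by (metis nonzero_mult_div_cancel_left)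
      have abs: "\<bar>a\<bar> \<le> int N" "\<bar>b\<bar> \<le> int N" using I by (auto simp: a_def b_def I_def)
      have "\<bar>a * b\<bar> \<le> int N * int N"
        unfolding abs_mult using abs by (intro mult_mono) auto
      have z6: "z6 = z1 + z2 + z3 - z4 - z5" using z by simp
      have "good x z3 z4 z5 (z1, z2)"
        using I m unfolding good_def x_def z6 by (simp add: algebra_simps)
      then have "good x z3 z4 z5 (base x z3 z4 z5)"
        unfolding base_def by (rule someI)
      then obtain w1 w2 where w: "base x z3 z4 z5 = (w1, w2)" "good x z3 z4 z5 (w1, w2)"
        by (metis surj_pair)
      have "a * (z1 - w1) + b * (z2 - w2) = 0"
        using w(2) \<open>good x z3 z4 z5 (z1, z2)\<close>
        unfolding good_def x_def a_def b_def by (simp add: algebra_simps)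
      moreover have "w1 \<in> I" "w2 \<in> I" using w(2) by (auto simp: good_def x_def)
      ultimately have "(a, b, z1 - w1, z2 - w2) \<in> K"
        using I abs unfolding K_def bilinear_solutions_def I_def by auto
      then have "((x6, z3, z4, z5), (a, b, z1 - w1, z2 - w2)) \<in> B"
        using I by (simp add: B_def)
      moreover have "u \<in> F ((x6, z3, z4, z5), (a, b, z1 - w1, z2 - w2))"
        using ab uv \<open>\<bar>a * b\<bar> \<le> int N * int N\<close> unfolding F_def by (auto intro: dvdI[OF uv[symmetric]])
      moreover have "s = h ((x6, z3, z4, z5), (a, b, z1 - w1, z2 - w2)) u"
      proof -
        have "x6 + a = x1" "x6 + b = x2" "x6 + (a + b) + u = x4" "x6 + (a + b) + a * b div u = x5"
          unfolding v[symmetric] by (simp_all add: a_def b_def u_def v_def)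
        moreover have "w1 + (z1 - w1) = z1" "w2 + (z2 - w2) = z2" by simp_all
        ultimately show ?thesis
          by (simp only: h_def e z6 prod.case Let_def x3[symmetric] x_def[symmetric] w(1) fst_conv snd_conv)
      qed
      ultimately show "s \<in> (\<Union>k\<in>B. h k ` F k)" by blast
    qed
    show "finite (F k)" "card (F k) \<le> D" for k
      unfolding F_def by (cases k; simp only: case_prod_beta divisors_at_mostD[OF D])+
  qed (auto simp: B_def I_def K_def finite_bilinear_solutions)
  also have "card B = (N + 1) ^ 4 * card K"
    unfolding B_def I_def card_cartesian_product[of _ K] card_box4 by simp
  finally show ?thesis by (simp add: S_def K_def)
qed

lemma card_twisted_solutions:
  assumes D: "divisors_at_most D (int N * int N)" and "D \<ge> 1" "N \<ge> 1"
  shows "card (twisted_solutions (int N) m) \<le> 5040 * D\<^sup>2 * N ^ 6"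
proof -
  define S where "S = {((x1, x2, x3, x4, x5, x6), z) \<in> twisted_solutions (int N) m. x6 \<in> {x1, x2, x3}}"
  define T where "T = {((x1, x2, x3, x4, x5, x6), z) \<in> twisted_solutions (int N) m. x6 \<notin> {x1, x2, x3}}"
  have "twisted_solutions (int N) m = S \<union> T"
    by (auto simp: S_def T_def)
  then have "card (twisted_solutions (int N) m) \<le> card S + card T"
    by (metis card_Un_le)
  also have "\<dots> \<le> 6 * (N + 1) ^ 4 * card (bilinear_solutions (int N) m)
      + (N + 1) ^ 4 * card (bilinear_solutions (int N) 0) * D"
    unfolding S_def T_def
    by (intro add_mono card_twisted_solutions_diagonal card_twisted_solutions_off_diagonal[OF D])
  also have "\<dots> \<le> 6 * (2 * N) ^ 4 * (45 * D * N\<^sup>2) + (2 * N) ^ 4 * (45 * D * N\<^sup>2) * D"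
    using assms by (intro add_mono mult_mono power_mono card_bilinear_solutions_nat) auto
  also have "\<dots> = 4320 * (D * N ^ 6) + 720 * (D * D * N ^ 6)"
  proof -
    have "N ^ 6 = N ^ 4 * N\<^sup>2" by (simp flip: power_add)
    then show ?thesis by (simp add: power_mult_distrib algebra_simps)
  qed
  also have "\<dots> \<le> 4320 * (D * D * N ^ 6) + 720 * (D * D * N ^ 6)"
    using \<open>D \<ge> 1\<close> by simp
  finally show ?thesis by (simp add: power2_eq_square)
qed

lemma energy_3:
  assumes "\<And>m. card (twisted_solutions (int N) m) \<le> M"
  shows "energy form_sum (tuples 3 N) \<le> (N + 1) ^ 5 * M"
proof -
  define I where "I = {0..int N}"
  define B where "B = I \<times> I \<times> I \<times> I \<times> I"
  define F where "F = (\<lambda>(y1, y2, y3, y4, y5). twisted_solutions (int N)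
      (y4\<^sup>2 + y5\<^sup>2 + (y1 + y2 + y3 - y4 - y5)\<^sup>2 - y1\<^sup>2 - y2\<^sup>2 - y3\<^sup>2))"
  define h :: "int \<times> int \<times> int \<times> int \<times> int \<Rightarrow>
      (int \<times> int \<times> int \<times> int \<times> int \<times> int) \<times> (int \<times> int \<times> int \<times> int \<times> int \<times> int) \<Rightarrow>
      (int \<times> int \<times> int) list \<times> (int \<times> int \<times> int) list" where
    "h = (\<lambda>(y1, y2, y3, y4, y5) ((x1, x2, x3, x4, x5, x6), (z1, z2, z3, z4, z5, z6)).
      ([(x1, y1, z1), (x2, y2, z2), (x3, y3, z3)],
       [(x4, y4, z4), (x5, y5, z5), (x6, y1 + y2 + y3 - y4 - y5, z6)]))"
  have "energy form_sum (tuples 3 N) \<le> card B * M"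
    unfolding energy_def
  proof (rule card_cover[where h = h and F = F])
    show "{(a, b). a \<in> tuples 3 N \<and> b \<in> tuples 3 N \<and> form_sum a = form_sum b} \<subseteq> (\<Union>k\<in>B. h k ` F k)"
    proof clarify
      fix l l' assume l: "l \<in> tuples 3 N" "l' \<in> tuples 3 N" and eq: "form_sum l = form_sum l'"
      obtain x1 y1 z1 x2 y2 z2 x3 y3 z3 where e: "l = [(x1, y1, z1), (x2, y2, z2), (x3, y3, z3)]"
        using l(1) by (auto simp: tuples_def numeral_3_eq_3 length_Suc_conv)
      obtain x4 y4 z4 x5 y5 z5 x6 y6 z6 where e': "l' = [(x4, y4, z4), (x5, y5, z5), (x6, y6, z6)]"
        using l(2) by (auto simp: tuples_def numeral_3_eq_3 length_Suc_conv)
      have I: "{y1, y2, y3, y4, y5} \<subseteq> I"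
        "{x1, x2, x3, x4, x5, x6, z1, z2, z3, z4, z5, z6} \<subseteq> {0..int N}"
        using l by (auto simp: e e' tuples_def cube_def I_def)
      have eqs: "x1 + x2 + x3 = x4 + x5 + x6" "y1 + y2 + y3 = y4 + y5 + y6"
        "z1 + z2 + z3 = z4 + z5 + z6" "x1\<^sup>2 + x2\<^sup>2 + x3\<^sup>2 = x4\<^sup>2 + x5\<^sup>2 + x6\<^sup>2"
        "(y1\<^sup>2 + x1 * z1) + (y2\<^sup>2 + x2 * z2) + (y3\<^sup>2 + x3 * z3) =
         (y4\<^sup>2 + x4 * z4) + (y5\<^sup>2 + x5 * z5) + (y6\<^sup>2 + x6 * z6)"
        using eq by (auto simp: e e' form_sum_def form_point_def zero_prod_def)
      have y6: "y6 = y1 + y2 + y3 - y4 - y5" using eqs(2) by simp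
      have "((x1, x2, x3, x4, x5, x6), (z1, z2, z3, z4, z5, z6)) \<in> F (y1, y2, y3, y4, y5)"
        unfolding F_def twisted_solutions_def using I(2) eqs(1,3,4,5) by (simp add: y6)
      moreover have "(y1, y2, y3, y4, y5) \<in> B" using I(1) by (simp add: B_def)
      moreover have "(l, l') = h (y1, y2, y3, y4, y5) ((x1, x2, x3, x4, x5, x6), (z1, z2, z3, z4, z5, z6))"
        by (simp add: h_def e e' y6)
      ultimately show "(l, l') \<in> (\<Union>k\<in>B. h k ` F k)" by blast
    qed
    show "finite (F k)" "card (F k) \<le> M" for k
      using assms finite_twisted_solutions by (cases k; auto simp: F_def)+
  qed (auto simp: B_def I_def)
  also have "card B = (N + 1) ^ 5"
  proof -
    have "card {0..int N} = N + 1" by simp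
    then show ?thesis
      unfolding B_def I_def card_cartesian_product[of _ "_ \<times> _ \<times> _ \<times> _"] card_box4
      by (simp only: power_Suc[symmetric] eval_nat_numeral)
  qed
  finally show ?thesis .
qed

lemma energy_3_le:
  assumes D: "divisors_at_most D (int N * int N)" and "D \<ge> 1" "N \<ge> 1"
  shows "energy form_sum (tuples 3 N) \<le> 161280 * D\<^sup>2 * N ^ 11"
proof -
  have "energy form_sum (tuples 3 N) \<le> (N + 1) ^ 5 * (5040 * D\<^sup>2 * N ^ 6)"
    by (intro energy_3 card_twisted_solutions assms)
  also have "\<dots> \<le> (2 * N) ^ 5 * (5040 * D\<^sup>2 * N ^ 6)"
    using assms by (intro mult_mono power_mono) auto
  also have "\<dots> = 161280 * D\<^sup>2 * N ^ 11"
    by (simp add: power_mult_distrib flip: power_add)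
  finally show ?thesis .
qed

section \<open>Asymptotic bounds\<close>

lemma J_2_bound:
  fixes \<epsilon> :: real
  assumes \<epsilon>: "\<epsilon> > 0"
  shows "\<exists>C\<ge>0. \<forall>N\<ge>1. real (J 2 N) \<le> C * real N powr (6 + \<epsilon>)"
proof -
  obtain C where C: "C \<ge> 0" and ex: "\<And>N. N \<ge> 1 \<Longrightarrow>
      \<exists>D\<ge>1. divisors_at_most D (4 * int N * int N) \<and> real D \<le> C * real N powr \<epsilon>"
    using ex_divisors_at_most[OF \<epsilon>] by blast
  have "real (J 2 N) \<le> 5760 * C * real N powr (6 + \<epsilon>)" if N: "N \<ge> 1" for N
  proof -
    obtain D where D: "D \<ge> 1" "divisors_at_most D (4 * int N * int N)" "real D \<le> C * real N powr \<epsilon>"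
      using ex[OF N] by blast
    have "J 2 N \<le> 5760 * D * N ^ 6"
      using J_le_energy energy_2_le[OF D(2,1) N] le_trans by blast
    then have "real (J 2 N) \<le> real (5760 * D * N ^ 6)"
      by (simp only: of_nat_le_iff)
    also have "\<dots> = 5760 * real D * real N powr 6"
      using N by (simp add: powr_numeral)
    also have "\<dots> \<le> 5760 * (C * real N powr \<epsilon>) * real N powr 6"
      using D by (intro mult_mono) auto
    finally show ?thesis by (simp add: powr_add mult_ac)
  qed
  then show ?thesis using C by (intro exI[of _ "5760 * C"]) auto
qed

lemma J_ge_3_bound:
  fixes \<epsilon> :: real
  assumes \<epsilon>: "\<epsilon> > 0" and s: "s \<ge> 3"
  shows "\<exists>C\<ge>0. \<forall>N\<ge>1. real (J s N) \<le> C * real N powr (6 * real s - 7 + \<epsilon>)"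
proof -
  obtain k where k: "s = 3 + k" using s le_Suc_ex by blast
  obtain C where C: "C \<ge> 0" and ex: "\<And>N. N \<ge> 1 \<Longrightarrow>
      \<exists>D\<ge>1. divisors_at_most D (4 * int N * int N) \<and> real D \<le> C * real N powr (\<epsilon> / 2)"
    using ex_divisors_at_most[of "\<epsilon> / 2"] \<epsilon> by auto
  define c :: nat where "c = 64 ^ k * 161280"
  have "real (J s N) \<le> real c * C\<^sup>2 * real N powr (6 * real s - 7 + \<epsilon>)" if N: "N \<ge> 1" for N
  proof -
    obtain D where D: "D \<ge> 1" "divisors_at_most D (4 * int N * int N)"
        "real D \<le> C * real N powr (\<epsilon> / 2)"
      using ex[OF N] by blast
    have D': "divisors_at_most D (int N * int N)"
      using D(2) by (rule divisors_at_most_mono) simp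
    have "J s N \<le> 64 ^ k * N ^ (6 * k) * energy form_sum (tuples 3 N)"
      unfolding k using J_le_energy energy_add[OF N] le_trans by blast
    also have "\<dots> \<le> 64 ^ k * N ^ (6 * k) * (161280 * D\<^sup>2 * N ^ 11)"
      by (intro mult_left_mono energy_3_le[OF D' D(1) N]) simp
    also have "\<dots> = c * D\<^sup>2 * N ^ (6 * k + 11)"
      by (simp add: c_def power_add mult_ac)
    finally have "real (J s N) \<le> real (c * D\<^sup>2 * N ^ (6 * k + 11))"
      by (simp only: of_nat_le_iff)
    also have "\<dots> = real c * (real D)\<^sup>2 * real N powr (6 * real s - 7)"
    proof -
      have "6 * real s - 7 = real (6 * k + 11)" by (simp add: k)
      then have "real N powr (6 * real s - 7) = real N ^ (6 * k + 11)"
        using N by (simp only: powr_realpow of_nat_0_less_iff)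
      then show ?thesis by simp
    qed
    also have "\<dots> \<le> real c * (C * real N powr (\<epsilon> / 2))\<^sup>2 * real N powr (6 * real s - 7)"
      using D by (intro mult_mono power_mono) auto
    also have "(C * real N powr (\<epsilon> / 2))\<^sup>2 = C\<^sup>2 * real N powr \<epsilon>"
      by (simp add: power_mult_distrib power2_eq_square flip: powr_add)
    finally show ?thesis by (simp add: powr_add mult_ac)
  qed
  then show ?thesis by (intro exI[of _ "real c * C\<^sup>2"]) auto
qed

lemma J_1_bound:
  fixes \<epsilon> :: real
  assumes \<epsilon>: "\<epsilon> > 0" and N: "N \<ge> 1"
  shows "real (J 1 N) \<le> 8 * real N powr (3 + \<epsilon>)"
proof -
  have "J 1 N \<le> (N + 1) ^ 3" using J_le_energy energy_1 le_trans by blast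
  also have "\<dots> \<le> (2 * N) ^ 3" using N by (intro power_mono) auto
  finally have "real (J 1 N) \<le> real ((2 * N) ^ 3)" by (simp only: of_nat_le_iff)
  also have "\<dots> = 8 * real N powr 3" using N by (simp add: power_mult_distrib powr_numeral)
  also have "\<dots> \<le> 8 * real N powr (3 + \<epsilon>)"
    using \<epsilon> N by (intro mult_left_mono powr_mono) auto
  finally show ?thesis .
qed

theorem mainTheorem4:
  shows "(\<forall>s::nat. s \<ge> 1 \<longrightarrow> (\<forall>\<epsilon>::real. \<epsilon> > 0 \<longrightarrow> (\<exists>C::real. \<forall>N::nat. N \<ge> 1 \<longrightarrow>
            real (J s N) \<le> C * (real N powr (3 * real s + \<epsilon>)
                               + real N powr (5 * real s - 4 + \<epsilon>)
                               + real N powr (6 * real s - 7 + \<epsilon>)))))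
       \<and> (\<forall>\<epsilon>::real. \<epsilon> > 0 \<longrightarrow> (\<exists>C::real. \<forall>N::nat. N \<ge> 1 \<longrightarrow>
            real (J 2 N) \<le> C * real N powr (6 + \<epsilon>)))"
proof (intro conjI allI impI)
  fix s :: nat and \<epsilon> :: real
  assume s: "s \<ge> 1" and \<epsilon>: "\<epsilon> > 0"
  let ?a = "\<lambda>N. real N powr (3 * real s + \<epsilon>)"
  let ?b = "\<lambda>N. real N powr (5 * real s - 4 + \<epsilon>)"
  let ?c = "\<lambda>N. real N powr (6 * real s - 7 + \<epsilon>)"
  have "\<exists>C\<ge>0. \<forall>N\<ge>1. real (J s N) \<le> C * ?a N \<or> real (J s N) \<le> C * ?c N"
  proof -
    consider "s = 1" | "s = 2" | "s \<ge> 3" using s by linarith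
    then show ?thesis
    proof cases
      case 1
      then show ?thesis using J_1_bound[OF \<epsilon>] by (intro exI[of _ 8]) auto
    next
      case 2
      then show ?thesis using J_2_bound[OF \<epsilon>] by auto
    next
      case 3
      then show ?thesis using J_ge_3_bound[OF \<epsilon> 3] by blast
    qed
  qed
  then obtain C where C: "C \<ge> 0"
    and J: "\<And>N. N \<ge> 1 \<Longrightarrow> real (J s N) \<le> C * ?a N \<or> real (J s N) \<le> C * ?c N"
    by blast
  have "real (J s N) \<le> C * (?a N + ?b N + ?c N)" if "N \<ge> 1" for N
  proof -
    have "C * ?a N \<le> C * (?a N + ?b N + ?c N)" "C * ?c N \<le> C * (?a N + ?b N + ?c N)"
      using C by (intro mult_left_mono; simp)+
    then show ?thesis using J[OF that] by linarith
  qed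
  then show "\<exists>C. \<forall>N\<ge>1. real (J s N) \<le> C * (?a N + ?b N + ?c N)" by blast
next
  fix \<epsilon> :: real assume "\<epsilon> > 0"
  then show "\<exists>C. \<forall>N\<ge>1. real (J 2 N) \<le> C * real N powr (6 + \<epsilon>)"
    using J_2_bound by blast
qed

end
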